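(* Let $t\ge 2$ and $r\ge 3$ be integers and let $m=r-1$. Then \[ \frac{m^{t-1}}{3\sqrt t}\;\le\;\tilde R_t(P_r^{(2)})\;\le\; t\,m^{t+1}. \]
   Context: An ordered ($k$-uniform) hypergraph is a $k$-uniform hypergraph whose vertex set is linearly ordered; a copy of an ordered hypergraph $G$ in an ordered hypergraph $H$ must respect the vertex orders. The monotone tight path $P_r^{(k)}$ is the ordered $k$-uniform hypergraph with vertex set $[r]=\{1,\dots,r\}$ (usual order) whose edges are all sets of $k$ consecutive vertices; for $k=2$ it is the monotone path with $r$ vertices and $r-1$ edges. The on-line Ramsey game with $t$ colors for a target ordered hypergraph $G$: on a large (unbounded) linearly ordered vertex supply, in each round Builder presents a new $k$-set (an edge), and Painter must immediately color it with one of $t$ colors; Builder wins when the colored edges contain a monochromatic copy of $G$ (in the ordered sense). The $t$-color on-line size Ramsey number $\tilde R_t(G)$ is the minimum number of rounds Builder needs to guarantee a win against any Painter strategy. *)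

theory Defs
  imports Complex_Main "HOL-Library.Extended_Real"
begin

record 'a hypergraph =
  verts :: "'a set"
  edges :: "'a set set"

definition monotone_tight_path :: "nat \<Rightarrow> nat \<Rightarrow> nat hypergraph" where
  "monotone_tight_path k r =
     \<lparr>verts = {1..r}, edges = {{i..<i + k} | i. 1 \<le> i \<and> i + k \<le> r + 1}\<rparr>"

definition contains_ordered_copy ::
  "'a::linorder hypergraph \<Rightarrow> 'b::linorder hypergraph \<Rightarrow> bool" where
  "contains_ordered_copy H G \<longleftrightarrow>
     (\<exists>f. strict_mono_on (verts G) f \<and> f ` verts G \<subseteq> verts H \<and>
          (\<forall>e\<in>edges G. f ` e \<in> edges H))"

text \<open>A history lists the rounds played so far, oldest first; each entry is the edge
  presented by Builder together with the color chosen by Painter. Colors are the numbers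
  below \<open>t\<close>.\<close>

type_synonym 'a history = "('a set \<times> nat) list"
type_synonym 'a builder = "'a history \<Rightarrow> 'a set"
type_synonym 'a painter = "'a history \<Rightarrow> 'a set \<Rightarrow> nat"

definition legal_edge :: "'a set \<Rightarrow> nat \<Rightarrow> 'a history \<Rightarrow> 'a set \<Rightarrow> bool" where
  "legal_edge V k h e \<longleftrightarrow> e \<subseteq> V \<and> finite e \<and> card e = k \<and> e \<notin> fst ` set h"

definition painter_strategy :: "nat \<Rightarrow> 'a painter \<Rightarrow> bool" where
  "painter_strategy t \<pi> \<longleftrightarrow> (\<forall>h e. \<pi> h e < t)"

fun play :: "'a builder \<Rightarrow> 'a painter \<Rightarrow> nat \<Rightarrow> 'a history" where
  "play \<sigma> \<pi> 0 = []"
| "play \<sigma> \<pi> (Suc n) = (let h = play \<sigma> \<pi> n; e = \<sigma> h in h @ [(e, \<pi> h e)])"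

definition monochromatic_copy ::
  "'a::linorder set \<Rightarrow> 'b::linorder hypergraph \<Rightarrow> 'a history \<Rightarrow> bool" where
  "monochromatic_copy V G h \<longleftrightarrow>
     (\<exists>c. contains_ordered_copy \<lparr>verts = V, edges = {e. (e, c) \<in> set h}\<rparr> G)"

text \<open>The legality of Builder's edges is only required up to the round in which Builder
  wins.\<close>

definition builder_forces ::
  "'a::linorder set \<Rightarrow> nat \<Rightarrow> nat \<Rightarrow> 'b::linorder hypergraph \<Rightarrow> nat \<Rightarrow> bool" where
  "builder_forces V k t G n \<longleftrightarrow>
     (\<exists>\<sigma>. \<forall>\<pi>. painter_strategy t \<pi> \<longrightarrow>
        (\<exists>j\<le>n. (\<forall>i<j. legal_edge V k (play \<sigma> \<pi> i) (\<sigma> (play \<sigma> \<pi> i))) \<and>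
               monochromatic_copy V G (play \<sigma> \<pi> j)))"

text \<open>The value is \<open>\<infinity>\<close> if Builder cannot force a win in any bounded number of rounds.\<close>

definition online_size_ramsey ::
  "'a::linorder set \<Rightarrow> nat \<Rightarrow> nat \<Rightarrow> 'b::linorder hypergraph \<Rightarrow> enat" where
  "online_size_ramsey V k t G = Inf {enat n | n. builder_forces V k t G n}"

end

theory Submission
  imports Defs
begin

text \<open>Both bounds compare the game with the grid {0,...,m-1}^t, one coordinate per color.
  Lower bound: vectors with a fixed coordinate sum form an antichain, so from any one of them to any
  other some coordinate strictly increases (\<open>sum_list_less_witness\<close>). Painter labels
  touched vertices by distinct vectors of one layer and colors each edge by a coordinate that
  increases along it. On a monochromatic path that coordinate strictly increases, so it cannot pass
  through r = m + 1 vertices. A round touches at most two new vertices, so Painter survives n rounds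
  whenever 2n is at most the size of the layer (\<open>painter_survives\<close>). By Chebyshev some
  layer has at least 2/3 m^(t-1) / sqrt t elements (\<open>large_layer\<close>). Upper bound:
  Builder fixes m^t + 1 vertices and attaches to each the vector of lengths of the longest path of
  each color ending there. Before a win this vector lies in the grid, so two vertices share it;
  joining them raises an entry of the upper one. The sum of all entries is thus a strictly growing
  potential, bounded by m^t * t * (m-1), since the lowest vertex contributes 0
  (\<open>builder_wins\<close>).\<close>

section \<open>A large layer of the grid\<close>

definition grid :: "nat \<Rightarrow> nat \<Rightarrow> nat list set" where
  "grid m t = {xs. set xs \<subseteq> {..<m} \<and> length xs = t}"

definition layer :: "nat \<Rightarrow> nat \<Rightarrow> nat \<Rightarrow> nat list set" where
  "layer m t s = {xs \<in> grid m t. sum_list xs = s}"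

text \<open>Twice the signed distance of the coordinate sum from its mean t(m-1)/2
  (\<open>deviation_eq\<close>); doubling keeps the value integral.\<close>

definition deviation :: "nat \<Rightarrow> nat list \<Rightarrow> real" where
  "deviation m xs = (\<Sum>x\<leftarrow>xs. 2 * real x - (real m - 1))"

lemma finite_grid [simp]: "finite (grid m t)"
  unfolding grid_def by (rule finite_lists_length_eq) simp

lemma card_grid: "card (grid m t) = m ^ t"
  unfolding grid_def by (simp add: card_lists_length_eq)

lemma finite_layer [simp]: "finite (layer m t s)"
  unfolding layer_def by simp

lemma grid_Suc: "grid m (Suc t) = (\<lambda>(x, xs). x # xs) ` ({..<m} \<times> grid m t)"
proof -
  have "ys \<in> (\<lambda>(x, xs). x # xs) ` ({..<m} \<times> grid m t)" if "ys \<in> grid m (Suc t)" for ys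
    using that by (cases ys) (auto simp: grid_def image_iff)
  then show ?thesis
    by (auto simp: grid_def)
qed

lemma sum_grid_Suc:
  "(\<Sum>xs\<in>grid m (Suc t). f xs) = (\<Sum>x<m. \<Sum>xs\<in>grid m t. f (x # xs))"
proof -
  have inj: "inj_on (\<lambda>(x, xs). x # xs) ({..<m} \<times> grid m t)"
    by (auto simp: inj_on_def)
  show ?thesis
    unfolding grid_Suc sum.reindex[OF inj]
    by (simp add: sum.cartesian_product comp_def case_prod_unfold)
qed

section \<open>Mean and variance of the coordinate sum\<close>

lemma deviation_Cons: "deviation m (x # xs) = (2 * real x - (real m - 1)) + deviation m xs"
  by (simp add: deviation_def)

lemma deviation_eq:
  assumes "xs \<in> grid m t"
  shows "deviation m xs = 2 * real (sum_list xs) - real t * (real m - 1)"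
proof -
  have "deviation m xs = 2 * real (sum_list xs) - real (length xs) * (real m - 1)"
    by (induction xs) (auto simp: deviation_def algebra_simps)
  then show ?thesis
    using assms by (simp add: grid_def)
qed

text \<open>The centre \<open>n\<close> is separate from the range \<open>m\<close> so that
  induction on \<open>m\<close> leaves the summand unchanged; at \<open>n = m\<close> the sum
  vanishes.\<close>

lemma sum_centered: "(\<Sum>x<m. 2 * real x - (real n - 1)) = real m * (real m - real n)"
  by (induction m) (auto simp: algebra_simps)

lemma sum_centered_square:
  "(\<Sum>x<m. (2 * real x - (real m - 1))\<^sup>2) = real m * ((real m)\<^sup>2 - 1) / 3"
proof -
  have "(\<Sum>x<m. (2 * real x - c)\<^sup>2) =
      2 * real m * (real m - 1) * (2 * real m - 1) / 3 - 2 * c * real m * (real m - 1) + real m * c\<^sup>2"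
    for c
    by (induction m) (auto simp: field_simps power2_eq_square)
  from this[of "real m - 1"] show ?thesis
    by (simp add: field_simps power2_eq_square)
qed

lemma sum_deviation: "(\<Sum>xs\<in>grid m t. deviation m xs) = 0"
proof (induction t)
  case 0
  then show ?case by (simp add: grid_def deviation_def)
next
  case (Suc t)
  have "(\<Sum>xs\<in>grid m (Suc t). deviation m xs)
      = (\<Sum>x<m. (\<Sum>xs\<in>grid m t. (2 * real x - (real m - 1)) + deviation m xs))"
    by (simp only: sum_grid_Suc deviation_Cons)
  also have "\<dots> = real (m ^ t) * (\<Sum>x<m. 2 * real x - (real m - 1))"
    by (simp only: sum.distrib Suc.IH sum_constant card_grid sum_distrib_left)
  finally show ?case by (simp only: sum_centered) simp
qed

text \<open>Variances of independent coordinates add, each contributing (m^2 - 1)/3; the cross terms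
  vanish by \<open>sum_deviation\<close>.\<close>

lemma sum_deviation_square:
  "(\<Sum>xs\<in>grid m t. (deviation m xs)\<^sup>2) = real m ^ t * real t * ((real m)\<^sup>2 - 1) / 3"
proof (induction t)
  case 0
  then show ?case by (simp add: grid_def deviation_def)
next
  case (Suc t)
  define d where "d x = 2 * real x - (real m - 1)" for x
  have "(\<Sum>xs\<in>grid m (Suc t). (deviation m xs)\<^sup>2)
      = (\<Sum>x<m. \<Sum>xs\<in>grid m t. (d x)\<^sup>2 + 2 * d x * deviation m xs + (deviation m xs)\<^sup>2)"
    by (simp only: sum_grid_Suc deviation_Cons d_def power2_sum ac_simps)
  also have "\<dots> = real (m ^ t) * (\<Sum>x<m. (d x)\<^sup>2)
      + real m * (\<Sum>xs\<in>grid m t. (deviation m xs)\<^sup>2)"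
    by (simp add: sum.distrib sum_distrib_left[symmetric] sum_deviation card_grid)
  also have "\<dots> = real m ^ Suc t * real (Suc t) * ((real m)\<^sup>2 - 1) / 3"
    unfolding Suc.IH d_def sum_centered_square by (simp add: field_simps)
  finally show ?case .
qed

text \<open>The condition puts s in an open interval of length k, and such an interval contains at
  most k integers.\<close>

lemma card_window:
  fixes c :: int and k :: nat
  shows "finite {s::nat. \<bar>2 * int s - c\<bar> < int k} \<and> card {s::nat. \<bar>2 * int s - c\<bar> < int k} \<le> k"
proof -
  define a where "a = (c - int k) div 2"
  have sub: "{s::nat. \<bar>2 * int s - c\<bar> < int k} \<subseteq> nat ` {a + 1..a + int k}"
  proof
    fix s :: nat
    assume "s \<in> {s. \<bar>2 * int s - c\<bar> < int k}"
    then have "int s \<in> {a + 1..a + int k}"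
      unfolding a_def by auto
    then show "s \<in> nat ` {a + 1..a + int k}"
      by (metis image_eqI nat_int)
  qed
  moreover have "card (nat ` {a + 1..a + int k}) \<le> k"
    using card_image_le[of "{a + 1..a + int k}" nat] by simp
  ultimately show ?thesis
    by (meson card_mono finite_atLeastAtMost_int finite_imageI finite_subset le_trans)
qed

text \<open>Chebyshev's inequality for the coordinate sum. The window length is rounded to an
  integer \<open>k\<close>, so that it meets at most \<open>k\<close> layers; the rounding error is absorbed by the
  \<open>-1\<close> in the variance.\<close>

lemma large_layer:
  assumes "2 \<le> t" "1 \<le> m"
  shows "\<exists>s. 2 / 3 * real m ^ (t - 1) / sqrt (real t) \<le> real (card (layer m t s))"
proof (rule ccontr)
  define b where "b = 2 / 3 * real m ^ (t - 1) / sqrt (real t)"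
  assume "\<not> (\<exists>s. 2 / 3 * real m ^ (t - 1) / sqrt (real t) \<le> real (card (layer m t s)))"
  then have small: "real (card (layer m t s)) \<le> b" for s
    unfolding b_def by (meson less_eq_real_def not_le)
  define q where "q = sqrt (real t)"
  \<comment> \<open>This \<open>w\<close> maximises (1 - t m^2 / (3 w^2)) / w, the Chebyshev
    estimate for the average share of a layer in a window of w layers. The maximum 2 / (3 w) yields
    the constant in \<open>b\<close>.\<close>
  define w where "w = real m * q"
  define k where "k = nat (round w)"
  define c where "c = int t * (int m - 1)"
  define I where "I = {s::nat. \<bar>2 * int s - c\<bar> < int k}"
  have q: "q\<^sup>2 = real t" "q > 1"
    using assms by (auto simp: q_def)
  have w1: "w \<ge> 1"
    using q assms unfolding w_def by (metis less_eq_real_def mult_ge1_I of_nat_1 of_nat_le_iff)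
  have kw: "\<bar>real k - w\<bar> \<le> 1 / 2"
  proof -
    have "round w \<ge> 0" using w1 round_mono[of 0 w] by simp
    then have "real k = of_int (round w)" by (simp add: k_def)
    then show ?thesis using of_int_round_abs_le[of w] by simp
  qed
  have I: "finite I" "card I \<le> k"
    using card_window[of c k] by (auto simp: I_def)
  define In where "In = {xs \<in> grid m t. \<bar>deviation m xs\<bar> < real k}"
  define Out where "Out = {xs \<in> grid m t. \<not> \<bar>deviation m xs\<bar> < real k}"
  have fin: "finite In" "finite Out" by (auto simp: In_def Out_def)
  have b0: "b \<ge> 0" by (simp add: b_def)
  have "In \<subseteq> (\<Union>s\<in>I. layer m t s)"
  proof
    fix xs assume xs: "xs \<in> In"
    then have "\<bar>2 * real (sum_list xs) - real t * (real m - 1)\<bar> < real k"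
      using deviation_eq[of xs m t] by (simp add: In_def)
    then have "\<bar>real_of_int (2 * int (sum_list xs) - c)\<bar> < real_of_int (int k)"
      by (simp add: c_def)
    then have "\<bar>2 * int (sum_list xs) - c\<bar> < int k"
      by linarith
    then show "xs \<in> (\<Union>s\<in>I. layer m t s)"
      using xs by (auto simp: I_def layer_def In_def)
  qed
  then have "card In \<le> card (\<Union>s\<in>I. layer m t s)"
    by (intro card_mono) (auto simp: I)
  also have "\<dots> \<le> (\<Sum>s\<in>I. card (layer m t s))"
    by (rule card_UN_le) (rule I)
  finally have "real (card In) \<le> (\<Sum>s\<in>I. real (card (layer m t s)))"
    by (metis of_nat_le_iff of_nat_sum)
  also have "\<dots> \<le> real (card I) * b"
    using sum_mono[of I "\<lambda>s. real (card (layer m t s))" "\<lambda>_. b"] small by simp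
  also have "\<dots> \<le> real k * b"
    using I b0 by (intro mult_right_mono) auto
  finally have inside: "real (card In) \<le> real k * b" .
  have "real (card Out) * (real k)\<^sup>2 = (\<Sum>xs\<in>Out. (real k)\<^sup>2)"
    by simp
  also have "\<dots> \<le> (\<Sum>xs\<in>Out. (deviation m xs)\<^sup>2)"
    by (intro sum_mono) (auto simp: Out_def abs_le_square_iff[symmetric])
  also have "\<dots> \<le> (\<Sum>xs\<in>grid m t. (deviation m xs)\<^sup>2)"
    by (intro sum_mono2) (auto simp: Out_def)
  finally have outside: "real (card Out) * (real k)\<^sup>2 \<le> real m ^ t * real t * ((real m)\<^sup>2 - 1) / 3"
    by (simp add: sum_deviation_square)
  have "In \<union> Out = grid m t" "In \<inter> Out = {}"
    by (auto simp: In_def Out_def)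
  then have "card In + card Out = m ^ t"
    using card_Un_disjoint[of In Out] fin by (simp add: card_grid)
  then have "real (m ^ t) = real (card In) + real (card Out)"
    by (metis of_nat_add)
  then have "real m ^ t * (real k)\<^sup>2 = real (card In) * (real k)\<^sup>2 + real (card Out) * (real k)\<^sup>2"
    by (simp add: algebra_simps)
  also have "\<dots> \<le> real k * b * (real k)\<^sup>2 + real m ^ t * real t * ((real m)\<^sup>2 - 1) / 3"
    using inside outside by (intro add_mono mult_right_mono) auto
  finally have main: "real m ^ t * (real k)\<^sup>2
      \<le> real k * b * (real k)\<^sup>2 + real m ^ t * real t * ((real m)\<^sup>2 - 1) / 3" .
  define p where "p = real m ^ (t - 1)"
  have p: "p > 0" "real m ^ t = p * real m"
    using assms by (auto simp: p_def power_Suc2[symmetric] Suc_diff_le simp del: power_Suc)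
  have b: "b * q = 2 / 3 * p"
    using q by (simp add: b_def q_def p_def)
  have "p * (3 * w * (real k)\<^sup>2) = 3 * q * (real m ^ t * (real k)\<^sup>2)"
    by (simp add: p w_def)
  also have "\<dots> \<le> 3 * q * (real k * b * (real k)\<^sup>2 + real m ^ t * real t * ((real m)\<^sup>2 - 1) / 3)"
    using main q by (intro mult_left_mono) auto
  also have "\<dots> = 3 * (b * q) * (real k) ^ 3 + q * (p * real m) * real t * ((real m)\<^sup>2 - 1)"
    unfolding p(2) by (simp add: field_simps power2_eq_square power3_eq_cube)
  also have "\<dots> = p * (2 * real k ^ 3 + w * (w\<^sup>2 - real t))"
    unfolding b w_def q(1)[symmetric] by (simp add: algebra_simps power2_eq_square power3_eq_cube)
  finally have "3 * w * (real k)\<^sup>2 \<le> 2 * real k ^ 3 + w * (w\<^sup>2 - real t)"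
    using p(1) by simp
  \<comment> \<open>The cubic 2 k^3 - 3 w k^2 + w^3 has a double root at k = w because w is the
    optimum. Rounding w to k therefore costs only a quadratic error, at most (3 w + 1)/4 < 2
    w.\<close>
  then have "w * real t \<le> (real k - w)\<^sup>2 * (2 * real k + w)"
    by (simp add: algebra_simps power2_eq_square power3_eq_cube)
  also have "\<dots> \<le> (1 / 2)\<^sup>2 * (3 * w + 1)"
  proof (intro mult_mono)
    show "(real k - w)\<^sup>2 \<le> (1 / 2)\<^sup>2"
      using kw by (subst abs_le_square_iff[symmetric]) simp
    show "2 * real k + w \<le> 3 * w + 1"
      using kw by linarith
  qed (use w1 in auto)
  also have "\<dots> < w * 2"
    using w1 by (simp add: power2_eq_square)
  also have "\<dots> \<le> w * real t"
    using w1 assms by (intro mult_left_mono) auto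
  finally show False by simp
qed

section \<open>The lower bound: an antichain strategy for Painter\<close>

text \<open>Otherwise \<open>ys\<close> lies below \<open>xs\<close> in every coordinate and
  strictly in one, so its sum is smaller.\<close>

lemma sum_list_less_witness:
  fixes xs ys :: "nat list"
  assumes "length xs = length ys" "sum_list xs \<le> sum_list ys" "xs \<noteq> ys"
  shows "\<exists>c<length xs. xs ! c < ys ! c"
proof (rule ccontr)
  assume "\<not> ?thesis"
  then have le: "ys ! c \<le> xs ! c" if "c < length xs" for c
    using that by (meson not_le)
  have "\<exists>c<length xs. ys ! c < xs ! c"
    using assms le by (metis le_neq_implies_less nth_equalityI)
  then have "(\<Sum>c<length xs. ys ! c) < (\<Sum>c<length xs. xs ! c)"
    using le by (intro sum_strict_mono_ex1) auto
  then show False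
    using assms by (simp add: sum_list_sum_nth atLeast0LessThan)
qed

text \<open>Numbers vertices by first appearance: the edge at position i (from 0) reserves 2i for
  its lower and 2i + 1 for its upper vertex. An endpoint touched earlier keeps its old number and
  leaves a gap, so n edges use numbers below 2n.\<close>

fun touch_index :: "'a::linorder set list \<Rightarrow> 'a \<Rightarrow> nat" where
  "touch_index [] v = 0"
| "touch_index (e # es) v = (if v \<in> e then of_bool (v \<noteq> Min e) else 2 + touch_index es v)"

text \<open>Labels are never revised, so those that Painter saw when coloring an edge are still
  valid at the end of the game.\<close>

lemma touch_index_append:
  "v \<in> \<Union>(set es) \<Longrightarrow> touch_index (es @ fs) v = touch_index es v"
  by (induction es) auto

lemma touch_index_less: "v \<in> \<Union>(set es) \<Longrightarrow> touch_index es v < 2 * length es"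
  by (induction es) auto

text \<open>Half the index, rounded down, gives the first edge containing the vertex, and the parity
  tells which end it is.\<close>

lemma touch_index_inj:
  assumes "\<forall>e\<in>set es. card e = 2" "u \<in> \<Union>(set es)" "v \<in> \<Union>(set es)"
    and "touch_index es u = touch_index es v"
  shows "u = v"
  using assms
proof (induction es)
  case (Cons e es)
  from Cons.prems(1) obtain a b where ab: "e = {a, b}" "a < b"
    by (auto simp: card_2_iff) (metis insert_commute linorder_neqE)
  have Min: "Min e = a" using ab by (simp add: min_def less_imp_le)
  consider "u \<in> e" "v \<in> e" | "u \<notin> e" "v \<notin> e" | "u \<in> e" "v \<notin> e" | "u \<notin> e" "v \<in> e"
    by blast
  then show ?case
  proof cases
    case 1
    then show ?thesis using Cons.prems(4) Min ab by (auto split: if_splits)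
  next
    case 2
    then show ?thesis using Cons by auto
  next
    case 3
    then show ?thesis using Cons.prems(4) by (cases "u = Min e") auto
  next
    case 4
    then show ?thesis using Cons.prems(4) by (cases "v = Min e") auto
  qed
qed simp

section \<open>Plays and the edges of the monotone path\<close>

lemma length_play [simp]: "length (play \<sigma> \<pi> n) = n"
  by (induction n) (auto simp: Let_def)

lemma play_prefix: "i \<le> j \<Longrightarrow> \<exists>h. play \<sigma> \<pi> j = play \<sigma> \<pi> i @ h"
  by (induction j) (auto simp: Let_def le_Suc_eq)

lemma set_play:
  "set (play \<sigma> \<pi> j) = (\<lambda>i. (\<sigma> (play \<sigma> \<pi> i), \<pi> (play \<sigma> \<pi> i) (\<sigma> (play \<sigma> \<pi> i)))) ` {..<j}"
  by (induction j) (auto simp: Let_def lessThan_Suc)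

lemma edges_monotone_path:
  "edges (monotone_tight_path 2 r) = {{i, Suc i} | i. 1 \<le> i \<and> i < r}"
proof -
  have "{i..<i + 2} = {i, Suc i}" for i :: nat
    by auto
  then show ?thesis
    by (auto simp: monotone_tight_path_def)
qed

lemma verts_monotone_path: "verts (monotone_tight_path 2 r) = {1..r}"
  by (simp add: monotone_tight_path_def)

text \<open>Painter gives each vertex, when it is first touched, a fresh element of the layer. As
  the layer is an antichain, Painter can color every edge by a coordinate that increases
  along it, and each coordinate takes only \<open>r - 1\<close> values.\<close>

lemma painter_survives:
  fixes V :: "'a::linorder set"
  assumes t: "0 < t" and r: "2 \<le> r" and n: "2 * n \<le> card (layer (r - 1) t s)"
  shows "\<not> builder_forces V 2 t (monotone_tight_path 2 r) n"
proof
  assume "builder_forces V 2 t (monotone_tight_path 2 r) n"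
  then obtain \<sigma> where \<sigma>: "\<And>\<pi>. painter_strategy t \<pi> \<Longrightarrow>
      \<exists>j\<le>n. (\<forall>i<j. legal_edge V 2 (play \<sigma> \<pi> i) (\<sigma> (play \<sigma> \<pi> i))) \<and>
             monochromatic_copy V (monotone_tight_path 2 r) (play \<sigma> \<pi> j)"
    unfolding builder_forces_def by blast
  obtain g where g: "bij_betw g {0..<card (layer (r - 1) t s)} (layer (r - 1) t s)"
    using ex_bij_betw_nat_finite[OF finite_layer] by blast
  define ok where "ok es e c \<longleftrightarrow> c < t \<and>
      g (touch_index es (Min e)) ! c < g (touch_index es (Max e)) ! c" for es :: "'a set list" and e c
  \<comment> \<open>The current edge is appended so that both its ends carry labels. In the rounds
    studied below a suitable coordinate exists; the value 0 makes the strategy total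
    elsewhere.\<close>
  define \<pi> where "\<pi> h e = (if \<exists>c. ok (map fst h @ [e]) e c
      then SOME c. ok (map fst h @ [e]) e c else 0)" for h :: "'a history" and e
  have "painter_strategy t \<pi>"
    unfolding painter_strategy_def
  proof (intro allI)
    fix h e
    show "\<pi> h e < t"
      using someI_ex[of "ok (map fst h @ [e]) e"] t by (auto simp: \<pi>_def ok_def)
  qed
  from \<sigma>[OF this] obtain j where j: "j \<le> n"
    and legal: "\<And>i. i < j \<Longrightarrow> legal_edge V 2 (play \<sigma> \<pi> i) (\<sigma> (play \<sigma> \<pi> i))"
    and "monochromatic_copy V (monotone_tight_path 2 r) (play \<sigma> \<pi> j)"
    by blast
  then obtain c f where f: "strict_mono_on {1..r} f"
    and edge: "\<forall>e\<in>{{i, Suc i} | i. 1 \<le> i \<and> i < r}. (f ` e, c) \<in> set (play \<sigma> \<pi> j)"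
    by (auto simp: monochromatic_copy_def contains_ordered_copy_def edges_monotone_path
        verts_monotone_path)
  have fe: "({f i, f (Suc i)}, c) \<in> set (play \<sigma> \<pi> j)" if "1 \<le> i" "i < r" for i
    using bspec[OF edge, of "{i, Suc i}"] that by auto
  define es where "es = map fst (play \<sigma> \<pi> j)"
  define lab where "lab v = g (touch_index es v)" for v
  have two: "\<forall>e\<in>set es. card e = 2"
    using legal by (auto simp: es_def set_play legal_edge_def)
  have lab_layer: "lab v \<in> layer (r - 1) t s" if "v \<in> \<Union>(set es)" for v
  proof -
    have "touch_index es v < card (layer (r - 1) t s)"
      using touch_index_less[OF that] n j by (simp add: es_def)
    then show ?thesis
      using g by (auto simp: lab_def bij_betw_def)
  qed
  have lab_inj: "lab u \<noteq> lab v" if "u \<in> \<Union>(set es)" "v \<in> \<Union>(set es)" "u \<noteq> v" for u v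
  proof -
    have "touch_index es u < card (layer (r - 1) t s)" "touch_index es v < card (layer (r - 1) t s)"
      using n j touch_index_less[OF that(1)] touch_index_less[OF that(2)]
      by (simp_all add: es_def)
    moreover have "touch_index es u \<noteq> touch_index es v"
      using touch_index_inj[OF two] that by blast
    ultimately show ?thesis
      using g by (auto simp: lab_def bij_betw_def inj_on_def)
  qed
  have incr: "c < t \<and> lab u ! c < lab v ! c" if e: "({u, v}, c) \<in> set (play \<sigma> \<pi> j)" and uv: "u < v" for u v
  proof -
    obtain i where i: "i < j" "{u, v} = \<sigma> (play \<sigma> \<pi> i)" "c = \<pi> (play \<sigma> \<pi> i) {u, v}"
      using e by (auto simp: set_play)
    define es' where "es' = map fst (play \<sigma> \<pi> i) @ [{u, v}]"
    obtain h where "play \<sigma> \<pi> j = play \<sigma> \<pi> (Suc i) @ h"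
      using play_prefix[of "Suc i" j \<sigma> \<pi>] i(1) by (metis Suc_leI)
    then have es: "es = es' @ map fst h"
      using i by (simp add: es_def es'_def Let_def)
    have "u \<in> \<Union>(set es')" "v \<in> \<Union>(set es')"
      by (auto simp: es'_def)
    then have lab: "lab u = g (touch_index es' u)" "lab v = g (touch_index es' v)"
      by (simp_all only: lab_def es touch_index_append)
    have in_es: "u \<in> \<Union>(set es)" "v \<in> \<Union>(set es)"
      by (auto simp: es es'_def)
    have "\<exists>c<t. lab u ! c < lab v ! c"
      using sum_list_less_witness[of "lab u" "lab v"] lab_layer[OF in_es(1)] lab_layer[OF in_es(2)]
        lab_inj[OF in_es] uv
      by (auto simp: layer_def grid_def)
    moreover have ok: "ok es' {u, v} c' \<longleftrightarrow> c' < t \<and> lab u ! c' < lab v ! c'" for c'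
      using uv by (simp add: ok_def lab min_def max_def less_imp_le)
    ultimately have ex: "\<exists>c'. ok es' {u, v} c'"
      by blast
    then have "c = (SOME c'. ok es' {u, v} c')"
      using i(3) by (simp add: \<pi>_def es'_def)
    then have "ok es' {u, v} c"
      using someI_ex[OF ex] by simp
    then show ?thesis
      using ok by blast
  qed
  have step: "c < t \<and> lab (f i) ! c < lab (f (Suc i)) ! c" if "1 \<le> i" "i < r" for i
    using that f by (intro incr fe) (auto simp: strict_mono_on_def)
  \<comment> \<open>The coordinate starts at 0 or more and gains at least 1 per edge. At the last
    vertex it reaches \<open>r - 1\<close>, while grid entries stay below
    \<open>r - 1\<close>.\<close>
  have grow: "i \<le> lab (f (Suc i)) ! c" if "i < r" for i
    using that
  proof (induction i)
    case (Suc i)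
    then show ?case using step[of "Suc i"] by simp
  qed simp
  have "f r \<in> \<Union>(set es)"
  proof -
    have "({f (r - 1), f r}, c) \<in> set (play \<sigma> \<pi> j)"
      using fe[of "r - 1"] r by simp
    then show ?thesis by (force simp: es_def)
  qed
  then have "lab (f r) ! c < r - 1"
    using lab_layer[of "f r"] step[of 1] r by (auto simp: layer_def grid_def subset_eq)
  moreover have "r - 1 \<le> lab (f r) ! c"
    using grow[of "r - 1"] r by simp
  ultimately show False by simp
qed

section \<open>The upper bound: longest monochromatic paths\<close>

text \<open>An increasing path with \<open>n\<close> edges ending at \<open>v\<close>, peeled from
  its top so that a new edge above the end adds one unfolding.\<close>

fun chain :: "'a::linorder set set \<Rightarrow> nat \<Rightarrow> 'a \<Rightarrow> bool" where
  "chain E 0 v \<longleftrightarrow> True"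
| "chain E (Suc n) v \<longleftrightarrow> (\<exists>u<v. {u, v} \<in> E \<and> chain E n u)"

text \<open>Dropping the lowest vertex shortens a path, so the lengths available at a vertex form an
  initial segment and are described by their maximum.\<close>

lemma chain_Suc: "chain E (Suc n) v \<Longrightarrow> chain E n v"
  by (induction n arbitrary: v) auto

lemma chain_le: "chain E n v \<Longrightarrow> k \<le> n \<Longrightarrow> chain E k v"
  by (induction n) (auto simp: le_Suc_eq dest: chain_Suc simp del: chain.simps(2))

lemma chain_mono: "chain E n v \<Longrightarrow> E \<subseteq> F \<Longrightarrow> chain F n v"
  by (induction n arbitrary: v) auto

text \<open>Turns the recursive predicate into an embedding of the path; fixing the image of the top
  vertex lets the induction append the next one.\<close>

lemma chain_path:
  assumes "chain E n v" "v \<in> V" "\<Union>E \<subseteq> V"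
  shows "\<exists>f. strict_mono_on {1..Suc n} f \<and> f ` {1..Suc n} \<subseteq> V \<and> f (Suc n) = v \<and>
    (\<forall>i. 1 \<le> i \<and> i \<le> n \<longrightarrow> {f i, f (Suc i)} \<in> E)"
  using assms(1,2)
proof (induction n arbitrary: v)
  case 0
  then show ?case by (intro exI[of _ "\<lambda>_. v"]) (auto simp: strict_mono_on_def)
next
  case (Suc n)
  then obtain u where u: "u < v" "{u, v} \<in> E" "chain E n u"
    by auto
  with assms(3) have "u \<in> V" by auto
  from Suc.IH[OF u(3) this] obtain f where f: "strict_mono_on {1..Suc n} f"
    "f ` {1..Suc n} \<subseteq> V" "f (Suc n) = u" "\<forall>i. 1 \<le> i \<and> i \<le> n \<longrightarrow> {f i, f (Suc i)} \<in> E"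
    by blast
  define f' where "f' = f(Suc (Suc n) := v)"
  have below: "f i \<le> u" if "1 \<le> i" "i \<le> Suc n" for i
    using strict_mono_on_leD[OF f(1), of i "Suc n"] that f(3) by auto
  have "strict_mono_on {1..Suc (Suc n)} f'"
  proof (rule strict_mono_onI)
    fix i k assume ik: "i \<in> {1..Suc (Suc n)}" "k \<in> {1..Suc (Suc n)}" "i < k"
    show "f' i < f' k"
    proof (cases "k = Suc (Suc n)")
      case True
      then show ?thesis using ik below[of i] u by (auto simp: f'_def)
    next
      case False
      then show ?thesis using ik strict_mono_onD[OF f(1), of i k] by (auto simp: f'_def)
    qed
  qed
  moreover have "f' ` {1..Suc (Suc n)} \<subseteq> V"
    using f(2) Suc.prems(2) by (auto simp: f'_def)
  moreover have "\<forall>i. 1 \<le> i \<and> i \<le> Suc n \<longrightarrow> {f' i, f' (Suc i)} \<in> E"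
    using f(3,4) u by (auto simp: f'_def le_Suc_eq)
  moreover have "f' (Suc (Suc n)) = v"
    by (simp add: f'_def)
  ultimately show ?case
    by blast
qed

definition color_class :: "'a history \<Rightarrow> nat \<Rightarrow> 'a set set" where
  "color_class h c = {e. (e, c) \<in> set h}"

lemma chain_monochromatic_copy:
  assumes "chain (color_class h c) (r - 1) v" "v \<in> V" "1 \<le> r" "\<forall>e\<in>fst ` set h. e \<subseteq> V"
  shows "monochromatic_copy V (monotone_tight_path 2 r) h"
proof -
  have "\<Union>(color_class h c) \<subseteq> V"
    using assms(4) by (force simp: color_class_def)
  from chain_path[OF assms(1,2) this] assms(3) obtain f where
    "strict_mono_on {1..r} f" "f ` {1..r} \<subseteq> V"
    "\<forall>i. 1 \<le> i \<and> i \<le> r - 1 \<longrightarrow> {f i, f (Suc i)} \<in> color_class h c"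
    by auto
  then show ?thesis
    unfolding monochromatic_copy_def contains_ordered_copy_def edges_monotone_path verts_monotone_path
    by (intro exI[of _ c] exI[of _ f]) (auto simp: color_class_def)
qed

text \<open>Builder joins two vertices that agree in the lengths of the longest monochromatic paths
  ending there, for every color. Whatever color Painter chooses, the upper vertex gets a
  longer path in it.\<close>

lemma builder_wins:
  fixes V :: "'a::linorder set"
  assumes V: "infinite V" and r: "2 \<le> r" and t: "0 < t"
  shows "builder_forces V 2 t (monotone_tight_path 2 r) (t * (r - 1) ^ (t + 1))"
proof -
  define m where "m = r - 1"
  have m: "1 \<le> m" using r by (simp add: m_def)
  \<comment> \<open>One vertex more than there are length vectors, for the pigeonhole
    principle.\<close>
  obtain S where S: "S \<subseteq> V" "finite S" "card S = m ^ t + 1"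
    using infinite_arbitrarily_large[OF V] by metis
  define s0 where "s0 = Min S"
  have Sne: "S \<noteq> {}" using S by auto
  have s0: "s0 \<in> S" "\<And>v. v \<in> S \<Longrightarrow> s0 \<le> v"
    using S Sne by (auto simp: s0_def)
  define won where "won h \<longleftrightarrow> monochromatic_copy V (monotone_tight_path 2 r) h" for h :: "'a history"
  define twins where "twins h u v \<longleftrightarrow> u \<in> S \<and> v \<in> S \<and> u < v \<and>
      (\<forall>c<t. \<forall>n. chain (color_class h c) n u \<longleftrightarrow> chain (color_class h c) n v)" for h u v
  define \<sigma> where "\<sigma> h = (SOME e. \<exists>u v. e = {u, v} \<and> twins h u v)" for h
  define inS where "inS h \<longleftrightarrow> (\<forall>e\<in>fst ` set h. e \<subseteq> S) \<and> snd ` set h \<subseteq> {..<t}" for h :: "'a history"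
  \<comment> \<open>The cutoff \<open>n < m\<close> makes the maximum range over a finite set;
    before a win it is the true longest length, by \<open>short\<close>.\<close>
  define len where "len h c v = Max {n. n < m \<and> chain (color_class h c) n v}" for h c and v :: 'a
  have short: "n < m" if "inS h" "\<not> won h" "v \<in> S" "chain (color_class h c) n v" for h c n v
  proof (rule ccontr)
    assume "\<not> n < m"
    then have "chain (color_class h c) (r - 1) v"
      using chain_le[OF that(4)] by (simp add: m_def)
    then have "won h"
      unfolding won_def
      by (rule chain_monochromatic_copy) (use that S r in \<open>auto simp: inS_def\<close>)
    with that show False by simp
  qed
  have len: "len h c v < m \<and> (\<forall>n. chain (color_class h c) n v \<longleftrightarrow> n \<le> len h c v)"
    if "inS h" "\<not> won h" "v \<in> S" for h c v
  proof -
    define N where "N = {n. n < m \<and> chain (color_class h c) n v}"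
    have "finite N" "0 \<in> N" using m by (auto simp: N_def)
    then have "len h c v \<in> N" "\<And>n. n \<in> N \<Longrightarrow> n \<le> len h c v"
      unfolding len_def N_def[symmetric] using Max_in[of N] by (auto simp del: Max_in)
    then show ?thesis
      using short[OF that] chain_le unfolding N_def by blast
  qed
  have ex_twins: "\<exists>u v. twins h u v" if h: "inS h" "\<not> won h" for h
  proof -
    define L where "L v = map (\<lambda>c. len h c v) [0..<t]" for v
    have "L ` S \<subseteq> {xs. set xs \<subseteq> {..<m} \<and> length xs = t}"
      using len[OF h] by (auto simp: L_def)
    then have "card (L ` S) \<le> m ^ t"
      using card_mono[OF finite_lists_length_eq[of "{..<m}" t]] by (simp add: card_lists_length_eq)
    then have "\<not> inj_on L S"
      using S card_image[of L S] by auto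
    then obtain u v where "u \<in> S" "v \<in> S" "u \<noteq> v" "L u = L v"
      by (auto simp: inj_on_def)
    then obtain u v where uv: "u \<in> S" "v \<in> S" "u < v" "L u = L v"
      by (metis linorder_neqE)
    have "len h c u = len h c v" if "c < t" for c
      using uv(4) that by (simp add: L_def)
    then have "twins h u v"
      using uv len[OF h] by (simp add: twins_def)
    then show ?thesis by blast
  qed
  have \<sigma>: "\<exists>u v. \<sigma> h = {u, v} \<and> twins h u v" if "inS h" "\<not> won h" for h
    using ex_twins[OF that] unfolding \<sigma>_def
    by (intro someI_ex[of "\<lambda>e. \<exists>u v. e = {u, v} \<and> twins h u v"]) blast
  \<comment> \<open>An edge already joining u to v in color c would extend the longest such path at
    u to v, so u and v could not be twins. Hence Builder never repeats an edge.\<close>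
  have new: "({u, v}, c) \<notin> set h" if h: "inS h" "\<not> won h" and tw: "twins h u v" for h u v c
  proof
    assume e: "({u, v}, c) \<in> set h"
    then have c: "c < t" using h by (auto simp: inS_def)
    have uv: "u \<in> S" "v \<in> S" "u < v" using tw by (auto simp: twins_def)
    have "chain (color_class h c) (len h c u) u"
      using len[OF h uv(1)] by simp
    then have "chain (color_class h c) (Suc (len h c u)) v"
      using uv e by (auto simp: color_class_def)
    then have "chain (color_class h c) (Suc (len h c u)) u"
      using tw c by (simp only: twins_def)
    then show False
      using len[OF h uv(1)] by (metis Suc_n_not_le_n)
  qed
  \<comment> \<open>Before a win, the cardinality of \<open>F h\<close> is the sum of all longest
    path lengths. The minimum \<open>s0\<close> is left out since no edge inside \<open>S\<close>
    reaches it from below, which leaves m^t vertices.\<close>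
  define F where "F h = {(v, c, n). v \<in> S - {s0} \<and> c < t \<and> n \<in> {1..<m} \<and> chain (color_class h c) n v}"
    for h
  have F_sub: "F h \<subseteq> (S - {s0}) \<times> {..<t} \<times> {1..<m}" for h
    by (auto simp: F_def)
  have F_fin: "finite (F h)" for h
    by (rule finite_subset[OF F_sub]) (use S in auto)
  have F_card: "card (F h) \<le> m ^ t * (t * (m - 1))" for h
    using card_mono[OF _ F_sub[of h]] S s0 by simp
  have "\<exists>j\<le>t * m ^ (t + 1). (\<forall>i<j. legal_edge V 2 (play \<sigma> \<pi> i) (\<sigma> (play \<sigma> \<pi> i))) \<and> won (play \<sigma> \<pi> j)"
    if \<pi>: "painter_strategy t \<pi>" for \<pi>
  proof -
    define h where "h i = play \<sigma> \<pi> i" for i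
    have h_Suc: "h (Suc i) = h i @ [(\<sigma> (h i), \<pi> (h i) (\<sigma> (h i)))]" for i
      by (simp add: h_def Let_def)
    have inv: "inS (h i) \<and> i \<le> card (F (h i))" if "\<forall>k\<le>i. \<not> won (h k)" for i
      using that
    proof (induction i)
      case 0
      then show ?case by (simp add: h_def inS_def)
    next
      case (Suc i)
      then have IH: "inS (h i)" "i \<le> card (F (h i))" and nw: "\<not> won (h i)" "\<not> won (h (Suc i))"
        by auto
      obtain u v where uv: "\<sigma> (h i) = {u, v}" "twins (h i) u v"
        using \<sigma>[OF IH(1) nw(1)] by blast
      define c where "c = \<pi> (h i) {u, v}"
      have c: "c < t" using \<pi> by (auto simp: c_def painter_strategy_def)
      have hS: "h (Suc i) = h i @ [({u, v}, c)]"
        using h_Suc uv by (simp add: c_def)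
      have uvS: "u \<in> S" "v \<in> S" "u < v" using uv by (auto simp: twins_def)
      have inS: "inS (h (Suc i))"
        using IH c uvS by (auto simp: hS inS_def)
      \<comment> \<open>Painter's color c gives v a path of length n + 1; its twin u had none that
        long before the move, hence neither had v, so (v, c, n + 1) is new in
        \<open>F\<close>.\<close>
      define n where "n = len (h i) c u"
      have "chain (color_class (h i) c) n u"
        using len[OF IH(1) nw(1) uvS(1)] by (simp add: n_def)
      then have "chain (color_class (h (Suc i)) c) n u"
        by (rule chain_mono) (auto simp: hS color_class_def)
      then have long: "chain (color_class (h (Suc i)) c) (Suc n) v"
        using uvS by (auto simp: hS color_class_def)
      have "Suc n < m"
        using short[OF inS nw(2) uvS(2) long] .
      moreover have "v \<noteq> s0"
        using s0(2)[OF uvS(1)] uvS(3) by auto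
      ultimately have "(v, c, Suc n) \<in> F (h (Suc i))"
        using long c uvS by (simp add: F_def del: chain.simps)
      moreover have "\<not> chain (color_class (h i) c) (Suc n) u"
        using len[OF IH(1) nw(1) uvS(1)] unfolding n_def by (metis Suc_n_not_le_n)
      then have "(v, c, Suc n) \<notin> F (h i)"
        using uv(2) c by (simp add: F_def twins_def del: chain.simps)
      moreover have "F (h i) \<subseteq> F (h (Suc i))"
        by (auto simp: F_def hS color_class_def elim!: chain_mono)
      ultimately have "F (h i) \<subset> F (h (Suc i))"
        by blast
      then have "card (F (h i)) < card (F (h (Suc i)))"
        by (rule psubset_card_mono[OF F_fin])
      with IH inS show ?case by simp
    qed
    have bound: "m ^ t * (t * (m - 1)) < t * m ^ (t + 1)"
    proof -
      have "m ^ t * (t * (m - 1)) < m ^ t * (t * m)"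
        using t m by simp
      then show ?thesis by (simp add: ac_simps)
    qed
    have "\<exists>j\<le>t * m ^ (t + 1). won (h j)"
    proof (rule ccontr)
      assume "\<not> ?thesis"
      then have "t * m ^ (t + 1) \<le> card (F (h (t * m ^ (t + 1))))"
        using inv by blast
      with F_card[of "h (t * m ^ (t + 1))"] bound show False by linarith
    qed
    then obtain k where k: "won (h k)" "k \<le> t * m ^ (t + 1)"
      by blast
    \<comment> \<open>Builder's choice is known to be legal only before a win, so the first winning
      round is taken.\<close>
    define j where "j = (LEAST i. won (h i))"
    have j: "won (h j)"
      unfolding j_def using k(1) by (rule LeastI)
    have least: "\<not> won (h i)" if "i < j" for i
      using that unfolding j_def by (rule not_less_Least)
    have "j \<le> k"
      unfolding j_def using k(1) by (rule Least_le)
    with k(2) have j_le: "j \<le> t * m ^ (t + 1)"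
      by (rule le_trans[rotated])
    have "legal_edge V 2 (h i) (\<sigma> (h i))" if "i < j" for i
    proof -
      have nw: "\<forall>k\<le>i. \<not> won (h k)" using least that by auto
      then have iS: "inS (h i)" using inv by blast
      obtain u v where uv: "\<sigma> (h i) = {u, v}" "twins (h i) u v"
        using \<sigma>[OF iS] nw by blast
      then have "u \<in> V" "v \<in> V" "u \<noteq> v" using S by (auto simp: twins_def)
      moreover have "{u, v} \<notin> fst ` set (h i)"
        using new[OF iS _ uv(2)] nw by force
      ultimately show ?thesis
        by (simp add: legal_edge_def uv)
    qed
    with j j_le show ?thesis
      unfolding h_def by blast
  qed
  then show ?thesis
    unfolding builder_forces_def won_def m_def by blast
qed

section \<open>Both bounds for the on-line size Ramsey number\<close>

theorem theorem2:
  fixes t r m :: nat and V :: "'a::linorder set"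
  assumes "t \<ge> 2" and "r \<ge> 3" and "m = r - 1" and "infinite V"
  shows "ereal (real m ^ (t - 1) / (3 * sqrt (real t)))
           \<le> ereal_of_enat (online_size_ramsey V 2 t (monotone_tight_path 2 r))
         \<and> ereal_of_enat (online_size_ramsey V 2 t (monotone_tight_path 2 r))
           \<le> ereal (real t * real m ^ (t + 1))"
proof
  define A where "A = {enat n | n. builder_forces V 2 t (monotone_tight_path 2 r) n}"
  have R: "online_size_ramsey V 2 t (monotone_tight_path 2 r) = Inf A"
    by (simp add: online_size_ramsey_def A_def)
  have upper: "enat (t * m ^ (t + 1)) \<in> A"
    using builder_wins[of V r t] assms by (auto simp: A_def)
  then have "Inf A \<le> enat (t * m ^ (t + 1))"
    by (rule Inf_lower)
  then have "ereal_of_enat (Inf A) \<le> ereal_of_enat (enat (t * m ^ (t + 1)))"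
    by (simp only: ereal_of_enat_le_iff)
  then show "ereal_of_enat (online_size_ramsey V 2 t (monotone_tight_path 2 r))
      \<le> ereal (real t * real m ^ (t + 1))"
    by (simp add: R)
  \<comment> \<open>The upper bound makes \<open>A\<close> nonempty, so the infimum is attained by a
    finite number of rounds.\<close>
  have "Inf A \<in> A"
    using upper by (metis Inf_enat_def LeastI empty_iff)
  then obtain n where n: "Inf A = enat n" "builder_forces V 2 t (monotone_tight_path 2 r) n"
    by (auto simp: A_def)
  obtain s where s: "2 / 3 * real m ^ (t - 1) / sqrt (real t) \<le> real (card (layer m t s))"
    using large_layer[of t m] assms(1-3) by force
  \<comment> \<open>Two labels per round halve the layer bound, turning 2/3 into 1/3.\<close>
  have "card (layer m t s) < 2 * n"
    using painter_survives[of t r n s V] n(2) assms by fastforce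
  then have "real (card (layer m t s)) \<le> 2 * real n"
    by linarith
  with s have "real m ^ (t - 1) / (3 * sqrt (real t)) \<le> real n"
    by (simp add: field_simps)
  then show "ereal (real m ^ (t - 1) / (3 * sqrt (real t)))
      \<le> ereal_of_enat (online_size_ramsey V 2 t (monotone_tight_path 2 r))"
    by (simp add: R n(1))
qed

end
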